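(* Let $\mathcal X=\{x_1,\dots,x_n\}$ be a set of $n$ distinct elements with a partial order $\lesssim$ and let $\mathbf y\in\mathbb{R}^n$. Let $\hat{\boldsymbol\theta}$ be the (unbounded) isotonic least squares estimator, let $\bar\theta_1<\bar\theta_2<\dots<\bar\theta_r$ be its distinct values, and let $U_1,\dots,U_r$ be the corresponding partition of $V=\{1,\dots,n\}$, so that $\hat\theta_i=\bar\theta_s$ for all $i\in U_s$. Let $\hat{\boldsymbol\theta}_\gamma$ be the bounded isotonic least squares estimator with boundedness parameter $\gamma$. Let $k_s=|U_s|$ for $s=1,\dots,r$ and define $$H(L,\gamma):=\sum_{s=1}^r k_s\,(L-\bar\theta_s)_+ +\sum_{s=1}^r k_s\,(L+\gamma-\bar\theta_s)_-,$$ where $(x)_+=\max\{x,0\}$ and $(x)_-=\min\{x,0\}$. Then for any given $\gamma$ with $\bar\theta_r-\bar\theta_1\ge\gamma\ge0$, $H(L,\gamma)$ is a continuous and strictly increasing function of $L$; moreover $\lim_{L\to-\infty}H(L,\gamma)=-\infty$ and $\lim_{L\to+\infty}H(L,\gamma)=+\infty$, so that there exists a unique $L_\gamma$ satisfying $H(L_\gamma,\gamma)=0$. Furthermore, $$\hat\theta_{\gamma,i}=\max\big(L_\gamma,\min(L_\gamma+\gamma,\bar\theta_s)\big)\qquad\text{for all } i\in U_s,\ s=1,\dots,r.$$ Moreover, $L_\gamma$ is nonincreasing in $\gamma$ (for $0\le\gamma\le\bar\theta_r-\bar\theta_1$).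
   Context: $V=\{1,\dots,n\}$ and $\widetilde E=\{(i,j): i\neq j,\ x_i\lesssim x_j\}$. The unbounded isotonic estimator is $\hat{\boldsymbol\theta}=\arg\min\{\|\boldsymbol\theta-\mathbf y\|_2^2:\boldsymbol\theta\in\mathbb{R}^n,\ \theta_i\le\theta_j\ \forall (i,j)\in\widetilde E\}$. Let $\max(V)=\{i\in V:\text{there is no }j\text{ with }(i,j)\in\widetilde E\}$ and $\min(V)=\{i\in V:\text{there is no }j\text{ with }(j,i)\in\widetilde E\}$. For $\gamma\ge0$ the bounded isotonic estimator is $\hat{\boldsymbol\theta}_\gamma=\arg\min_{\boldsymbol\theta\in\mathcal C}\|\mathbf y-\boldsymbol\theta\|_2^2$ with $$\mathcal C=\{\boldsymbol\theta\in\mathbb{R}^n:\theta_i\le\theta_j\ \forall (i,j)\in\widetilde E,\ \ \theta_i\le\theta_j+\gamma\ \ \forall i\in\max(V),\, j\in\min(V),\, i\ne j\}.$$ *)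

theory Defs
  imports "HOL-Analysis.Analysis"
begin

(* The vertex set V = {1,...,n} is rendered as a finite (hence nonempty) index type 'n with
   n = CARD('n), and R^n as real ^ 'n.  The partial order on the points x i is an arbitrary
   relation R on range x. *)

definition isotonic_edges :: "'a rel \<Rightarrow> ('n \<Rightarrow> 'a) \<Rightarrow> 'n rel" where
  "isotonic_edges R x = {(i, j). i \<noteq> j \<and> (x i, x j) \<in> R}"

definition max_vertices :: "'n rel \<Rightarrow> 'n set" where
  "max_vertices E = {i. \<not> (\<exists>j. (i, j) \<in> E)}"

definition min_vertices :: "'n rel \<Rightarrow> 'n set" where
  "min_vertices E = {i. \<not> (\<exists>j. (j, i) \<in> E)}"

definition isotonic_cone :: "'n rel \<Rightarrow> (real ^ 'n::finite) set" where
  "isotonic_cone E = {\<theta>. \<forall>(i, j) \<in> E. \<theta> $ i \<le> \<theta> $ j}"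

definition bounded_isotonic_set :: "'n rel \<Rightarrow> real \<Rightarrow> (real ^ 'n::finite) set" where
  "bounded_isotonic_set E \<gamma> = {\<theta>.
     (\<forall>(i, j) \<in> E. \<theta> $ i \<le> \<theta> $ j) \<and>
     (\<forall>i \<in> max_vertices E. \<forall>j \<in> min_vertices E. i \<noteq> j \<longrightarrow> \<theta> $ i \<le> \<theta> $ j + \<gamma>)}"

definition isotonic_lse :: "'n rel \<Rightarrow> real ^ 'n \<Rightarrow> real ^ 'n::finite" where
  "isotonic_lse E y = arg_min_on (\<lambda>\<theta>. (norm (\<theta> - y))\<^sup>2) (isotonic_cone E)"

definition bounded_isotonic_lse :: "'n rel \<Rightarrow> real ^ 'n \<Rightarrow> real \<Rightarrow> real ^ 'n::finite" where
  "bounded_isotonic_lse E y \<gamma> =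
     arg_min_on (\<lambda>\<theta>. (norm (y - \<theta>))\<^sup>2) (bounded_isotonic_set E \<gamma>)"

(* Here (t)_- is min t 0, which is nonpositive. *)

definition level_H :: "nat \<Rightarrow> (nat \<Rightarrow> nat) \<Rightarrow> (nat \<Rightarrow> real) \<Rightarrow> real \<Rightarrow> real \<Rightarrow> real" where
  "level_H r k \<theta>b L \<gamma> =
     (\<Sum>s=1..r. real (k s) * max (L - \<theta>b s) 0) +
     (\<Sum>s=1..r. real (k s) * min (L + \<gamma> - \<theta>b s) 0)"

(* Meaningful only when the root is unique. *)

definition level_root :: "nat \<Rightarrow> (nat \<Rightarrow> nat) \<Rightarrow> (nat \<Rightarrow> real) \<Rightarrow> real \<Rightarrow> real" where
  "level_root r k \<theta>b \<gamma> = (THE L. level_H r k \<theta>b L \<gamma> = 0)"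

(* Both estimators are projections onto nonempty closed convex sets, so arg_min_on, which
   chooses an arbitrary minimiser, picks the only one. *)

lemma closed_convex_nonempty_isotonic_cone:
  "closed (isotonic_cone E)" "convex (isotonic_cone E)" "isotonic_cone E \<noteq> {}"
proof -
  have *: "isotonic_cone E = (\<Inter>p\<in>E. {\<theta>. \<theta> $ fst p \<le> \<theta> $ snd p})"
    by (fastforce simp: isotonic_cone_def)
  show "closed (isotonic_cone E)"
    unfolding * by (intro closed_INT ballI closed_Collect_le continuous_intros)
  show "convex (isotonic_cone E)"
    unfolding *
    by (intro convex_INT) (auto simp: convex_alt intro!: add_mono mult_left_mono)
  have "0 \<in> isotonic_cone E"
    by (auto simp: isotonic_cone_def)
  then show "isotonic_cone E \<noteq> {}" by blast
qed

lemma closed_convex_nonempty_bounded_isotonic_set: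
  "closed (bounded_isotonic_set E \<gamma>)" "convex (bounded_isotonic_set E \<gamma>)"
  "0 \<le> \<gamma> \<Longrightarrow> bounded_isotonic_set E \<gamma> \<noteq> {}"
proof -
  let ?P = "{p \<in> max_vertices E \<times> min_vertices E. fst p \<noteq> snd p}"
  have *: "bounded_isotonic_set E \<gamma> =
      isotonic_cone E \<inter> (\<Inter>p\<in>?P. {\<theta>. \<theta> $ fst p \<le> \<theta> $ snd p + \<gamma>})"
    by (auto simp: isotonic_cone_def bounded_isotonic_set_def)
  show "closed (bounded_isotonic_set E \<gamma>)"
    unfolding *
    by (intro closed_Int closed_INT ballI closed_Collect_le continuous_intros
        closed_convex_nonempty_isotonic_cone)
  have "convex {\<theta>::real^'n. \<theta> $ i \<le> \<theta> $ j + \<gamma>}" for i j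
  proof -
    have "{\<theta>::real^'n. \<theta> $ i \<le> \<theta> $ j + \<gamma>} = {\<theta>. inner (axis i 1 - axis j 1) \<theta> \<le> \<gamma>}"
      by (auto simp: inner_diff_left inner_axis')
    then show ?thesis by (simp add: convex_halfspace_le)
  qed
  then show "convex (bounded_isotonic_set E \<gamma>)"
    unfolding *
    by (intro convex_Int convex_INT closed_convex_nonempty_isotonic_cone)
  assume "0 \<le> \<gamma>"
  then have "0 \<in> bounded_isotonic_set E \<gamma>"
    by (auto simp: bounded_isotonic_set_def)
  then show "bounded_isotonic_set E \<gamma> \<noteq> {}" by blast
qed

lemma is_arg_min_projection_iff:
  fixes y :: "real ^ 'n::finite"
  assumes "closed S" "convex S" "S \<noteq> {}"
  shows "is_arg_min (\<lambda>\<theta>. (norm (\<theta> - y))\<^sup>2) (\<lambda>\<theta>. \<theta> \<in> S) \<theta> \<longleftrightarrow> \<theta> = closest_point S y"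
proof -
  have "is_arg_min (\<lambda>\<theta>. (norm (\<theta> - y))\<^sup>2) (\<lambda>\<theta>. \<theta> \<in> S) \<theta> \<longleftrightarrow>
      \<theta> \<in> S \<and> (\<forall>z\<in>S. dist y \<theta> \<le> dist y z)" for \<theta>
    by (auto simp: is_arg_min_linorder dist_norm norm_minus_commute)
  then show ?thesis
    using closest_point_exists[of S y] closest_point_unique[of S \<theta> y] assms by auto
qed

lemma isotonic_lse_unique:
  "is_arg_min (\<lambda>\<theta>. (norm (\<theta> - y))\<^sup>2) (\<lambda>\<theta>. \<theta> \<in> isotonic_cone E) \<theta> \<longleftrightarrow> \<theta> = isotonic_lse E y"
  using is_arg_min_projection_iff[OF closed_convex_nonempty_isotonic_cone, of y E]
  by (simp add: isotonic_lse_def arg_min_on_def arg_min_def)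

lemma bounded_isotonic_lse_unique:
  assumes "0 \<le> \<gamma>"
  shows "is_arg_min (\<lambda>\<theta>. (norm (y - \<theta>))\<^sup>2) (\<lambda>\<theta>. \<theta> \<in> bounded_isotonic_set E \<gamma>) \<theta> \<longleftrightarrow>
    \<theta> = bounded_isotonic_lse E y \<gamma>"
  using is_arg_min_projection_iff[OF closed_convex_nonempty_bounded_isotonic_set, OF assms, of y E]
  by (simp add: bounded_isotonic_lse_def arg_min_on_def arg_min_def norm_minus_commute)

end

theory Submission
  imports Defs
begin

text \<open>
  Clipping \<open>t\<close> to the window \<open>[L, L + \<gamma>]\<close> changes it by
  \<open>(L - t)\<^sub>+ + (L + \<gamma> - t)\<^sub>-\<close>, so \<open>H(L, \<gamma>)\<close> is the total change of the
  coordinates of \<open>\<theta>hat\<close> under clipping (\<open>level_H_eq_sum_clip\<close>), and \<open>L\<^sub>\<gamma>\<close> is the level at which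
  clipping preserves their sum. Monotonicity of the clip in \<open>L\<close> and in \<open>\<gamma>\<close> gives the claims about \<open>H\<close>
  and the antimonotonicity of the root. The increase in \<open>L\<close> is strict because, as the level rises from
  \<open>L\<close> to \<open>L'\<close>, a clipped coordinate stays put only if the coordinate lies in \<open>[L', L + \<gamma>]\<close>; this
  interval is shorter than the range of \<open>\<theta>hat\<close> and misses some coordinate.

  For the formula, a finite order has a maximal vertex above and a minimal vertex below every vertex,
  so a bounded isotonic vector has all its coordinates in some window \<open>[m, m + \<gamma>]\<close>
  (\<open>bounded_isotonic_set_spread\<close>). Let \<open>\<theta>\<^sup>*\<close> be \<open>\<theta>hat\<close> clipped at level \<open>L\<^sub>\<gamma>\<close>. It is feasible, and it is the
  projection of \<open>y\<close> as soon as \<open>(y - \<theta>\<^sup>*) \<bullet> (z - \<theta>\<^sup>*) \<le> 0\<close> for all feasible \<open>z\<close>. Split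
  \<open>y - \<theta>\<^sup>* = (y - \<theta>hat) + (\<theta>hat - \<theta>\<^sup>*)\<close>. The first part has nonpositive
  inner product with every isotonic vector and is orthogonal to \<open>\<theta>\<^sup>*\<close>, because \<open>\<theta>hat + \<theta>\<^sup>*\<close> and
  \<open>\<theta>hat - \<theta>\<^sup>*\<close> are both isotonic (\<open>isotonic_lse_residual_orthogonal\<close>); for the difference this holds
  since clipping is a contraction. In the second part, \<open>z\<^sub>i - \<theta>\<^sup>*\<^sub>i\<close> may be replaced by the
  constant \<open>m - L\<^sub>\<gamma>\<close>, which then multiplies the sum \<open>\<Sum>i. \<theta>hat\<^sub>i - \<theta>\<^sup>*\<^sub>i = 0\<close>
  (\<open>sum_clip_obtuse\<close>).
\<close>

section \<open>Clipping to a window\<close>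

definition clip :: "real \<Rightarrow> real \<Rightarrow> real \<Rightarrow> real" where
  "clip L \<gamma> t = max L (min (L + \<gamma>) t)"

lemma clip_diff: "0 \<le> \<gamma> \<Longrightarrow> clip L \<gamma> t - t = max (L - t) 0 + min (L + \<gamma> - t) 0"
  by (auto simp: clip_def max_def min_def)

lemma clip_mono: "s \<le> t \<Longrightarrow> clip L \<gamma> s \<le> clip L \<gamma> t"
  by (auto simp: clip_def)

lemma clip_contracts: "s \<le> t \<Longrightarrow> clip L \<gamma> t - clip L \<gamma> s \<le> t - s"
  by (auto simp: clip_def max_def min_def)

lemma clip_mono_level: "L \<le> L' \<Longrightarrow> \<gamma> \<le> \<gamma>' \<Longrightarrow> clip L \<gamma> t \<le> clip L' \<gamma>' t"
  by (auto simp: clip_def max_def min_def)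

lemma sum_clip_strict_mono:
  fixes c :: "'n::finite \<Rightarrow> real"
  assumes "0 \<le> \<gamma>" "\<gamma> \<le> c b - c a"
  shows "strict_mono (\<lambda>L. \<Sum>i\<in>UNIV. clip L \<gamma> (c i) - c i)"
proof (rule strict_monoI)
  fix L L' :: real
  assume "L < L'"
  have "\<exists>i. clip L \<gamma> (c i) < clip L' \<gamma> (c i)"
  proof (cases "c a < L'")
    case True
    then have "clip L \<gamma> (c a) < clip L' \<gamma> (c a)"
      using \<open>L < L'\<close> assms by (auto simp: clip_def max_def min_def)
    then show ?thesis ..
  next
    \<comment> \<open>Here \<open>L < c a\<close>, so the window \<open>[L, L + \<gamma>]\<close> is too short to reach \<open>c b\<close>.\<close>
    case False
    then have "clip L \<gamma> (c b) < clip L' \<gamma> (c b)"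
      using \<open>L < L'\<close> assms by (auto simp: clip_def max_def min_def)
    then show ?thesis ..
  qed
  then show "(\<Sum>i\<in>UNIV. clip L \<gamma> (c i) - c i) < (\<Sum>i\<in>UNIV. clip L' \<gamma> (c i) - c i)"
    using \<open>L < L'\<close> by (intro sum_strict_mono_ex1) (auto intro: clip_mono_level)
qed

lemma continuous_on_sum_clip:
  fixes c :: "'n::finite \<Rightarrow> real"
  shows "continuous_on UNIV (\<lambda>L. \<Sum>i\<in>UNIV. clip L \<gamma> (c i) - c i)"
  unfolding clip_def by (intro continuous_intros)

text \<open>
  Once \<open>L\<close> exceeds every coordinate, clipping lowers none of them, and the change \<open>L - c a\<close> of a
  single coordinate bounds the sum from below.
\<close>

lemma filterlim_sum_clip_at_top:
  fixes c :: "'n::finite \<Rightarrow> real"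
  assumes "0 \<le> \<gamma>"
  shows "filterlim (\<lambda>L. \<Sum>i\<in>UNIV. clip L \<gamma> (c i) - c i) at_top at_top"
proof (rule filterlim_at_top_mono)
  fix a :: 'n
  show "filterlim (\<lambda>L. L - c a) at_top at_top"
    using filterlim_tendsto_add_at_top[OF tendsto_const filterlim_ident, of "- c a"] by simp
  have "L - c a \<le> (\<Sum>i\<in>UNIV. clip L \<gamma> (c i) - c i)" if "Max (range c) \<le> L" for L
  proof -
    have le: "c i \<le> L" for i
      using that Max_ge[of "range c" "c i"] by simp
    have "L - c a \<le> clip L \<gamma> (c a) - c a"
      by (simp add: clip_def)
    also have "\<dots> \<le> (\<Sum>i\<in>UNIV. clip L \<gamma> (c i) - c i)"
      by (rule member_le_sum) (use le in \<open>auto simp: clip_def le_max_iff_disj\<close>)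
    finally show ?thesis .
  qed
  then show "\<forall>\<^sub>F L in at_top. L - c a \<le> (\<Sum>i\<in>UNIV. clip L \<gamma> (c i) - c i)"
    using eventually_ge_at_top by (rule eventually_mono[rotated])
qed

text \<open>
  Negating coordinates and window exchanges the two ends of the window, which turns the limit at
  \<open>-\<infinity>\<close> into the one at \<open>+\<infinity>\<close>.
\<close>

lemma clip_uminus: "0 \<le> \<gamma> \<Longrightarrow> clip (- L - \<gamma>) \<gamma> (- t) = - clip L \<gamma> t"
  by (auto simp: clip_def max_def min_def)

lemma filterlim_sum_clip_at_bot:
  fixes c :: "'n::finite \<Rightarrow> real"
  assumes "0 \<le> \<gamma>"
  shows "filterlim (\<lambda>L. \<Sum>i\<in>UNIV. clip L \<gamma> (c i) - c i) at_bot at_bot"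
proof -
  have "filterlim (\<lambda>L::real. - \<gamma> + - L) at_top at_bot"
    by (rule filterlim_tendsto_add_at_top[OF tendsto_const filterlim_uminus_at_top_at_bot])
  then have "filterlim (\<lambda>L. \<Sum>i\<in>UNIV. clip (- \<gamma> + - L) \<gamma> (- c i) - - c i) at_top at_bot"
    by (rule filterlim_compose[OF filterlim_sum_clip_at_top[OF assms]])
  moreover have "(\<Sum>i\<in>UNIV. clip (- \<gamma> + - L) \<gamma> (- c i) - - c i) =
      - (\<Sum>i\<in>UNIV. clip L \<gamma> (c i) - c i)" for L
    using clip_uminus[OF assms, of L] by (simp add: sum_negf[symmetric] add.commute)
  ultimately show ?thesis
    by (simp add: filterlim_uminus_at_bot)
qed

lemma sum_clip_unique_root:
  fixes c :: "'n::finite \<Rightarrow> real"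
  assumes "0 \<le> \<gamma>" "\<gamma> \<le> c b - c a"
  shows "\<exists>!L. (\<Sum>i\<in>UNIV. clip L \<gamma> (c i) - c i) = 0"
proof -
  let ?H = "\<lambda>L. \<Sum>i\<in>UNIV. clip L \<gamma> (c i) - c i"
  have sm: "strict_mono ?H"
    by (rule sum_clip_strict_mono[OF assms])
  obtain lo where lo: "?H lo \<le> 0"
    using filterlim_sum_clip_at_bot[OF assms(1), of c, unfolded filterlim_at_bot, rule_format, of 0]
    by (auto simp: eventually_at_bot_linorder)
  obtain hi where hi: "0 \<le> ?H hi"
    using filterlim_sum_clip_at_top[OF assms(1), of c, unfolded filterlim_at_top, rule_format, of 0]
    by (auto simp: eventually_at_top_linorder)
  have "lo \<le> hi"
    using lo hi strict_mono_less_eq[OF sm, of lo hi] by linarith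
  then obtain L where "?H L = 0"
    using IVT'[of ?H lo 0 hi] lo hi continuous_on_subset[OF continuous_on_sum_clip] by blast
  moreover have "L' = L" if "?H L' = 0" for L'
    using strict_mono_eq[OF sm, of L' L] that \<open>?H L = 0\<close> by simp
  ultimately show ?thesis
    by (rule ex1I)
qed

text \<open>
  Where the clip lowers \<open>c i\<close> it equals \<open>L + \<gamma>\<close>, and \<open>z i \<le> m + \<gamma>\<close>; where it raises
  \<open>c i\<close> it equals \<open>L\<close>, and \<open>z i \<ge> m\<close>. Either way replacing \<open>z i - clip L \<gamma> (c i)\<close> by
  \<open>m - L\<close> can only increase the summand, and the resulting sum is zero.
\<close>

lemma sum_clip_obtuse:
  fixes c z :: "'n::finite \<Rightarrow> real"
  assumes root: "(\<Sum>i\<in>UNIV. clip L \<gamma> (c i) - c i) = 0"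
    and "0 \<le> \<gamma>" and z: "\<And>i. m \<le> z i" "\<And>i. z i \<le> m + \<gamma>"
  shows "(\<Sum>i\<in>UNIV. (c i - clip L \<gamma> (c i)) * (z i - clip L \<gamma> (c i))) \<le> 0"
proof -
  have term_le: "(c i - clip L \<gamma> (c i)) * (z i - clip L \<gamma> (c i)) \<le> (c i - clip L \<gamma> (c i)) * (m - L)" for i
  proof -
    consider "c i < L" "clip L \<gamma> (c i) = L" | "clip L \<gamma> (c i) = c i"
      | "L + \<gamma> < c i" "clip L \<gamma> (c i) = L + \<gamma>"
      using \<open>0 \<le> \<gamma>\<close> unfolding clip_def by linarith
    then show ?thesis
    proof cases
      case 1
      then show ?thesis using z(1)[of i] by (auto intro: mult_left_mono_neg)
    next
      case 2
      then show ?thesis by simp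
    next
      case 3
      then show ?thesis using z(2)[of i] by (auto intro: mult_left_mono)
    qed
  qed
  have "(\<Sum>i\<in>UNIV. (c i - clip L \<gamma> (c i)) * (z i - clip L \<gamma> (c i)))
      \<le> (\<Sum>i\<in>UNIV. (c i - clip L \<gamma> (c i)) * (m - L))"
    by (rule sum_mono) (rule term_le)
  also have "\<dots> = - (\<Sum>i\<in>UNIV. clip L \<gamma> (c i) - c i) * (m - L)"
    by (simp add: sum_distrib_right[symmetric] sum_negf[symmetric])
  finally show ?thesis
    using root by simp
qed

section \<open>The isotonic cone and the bounded isotonic set\<close>

lemma trans_irrefl_isotonic_edges:
  assumes "inj x" "partial_order_on (range x) R"
  shows "trans (isotonic_edges R x)" "irrefl (isotonic_edges R x)"
proof -
  have tr: "trans R" and as: "antisym R"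
    using assms(2) by (auto simp: partial_order_on_def preorder_on_def)
  show "trans (isotonic_edges R x)"
  proof (rule transI)
    fix i j l
    assume ij: "(i, j) \<in> isotonic_edges R x" and jl: "(j, l) \<in> isotonic_edges R x"
    have "i \<noteq> l"
      using ij jl antisymD[OF as, of "x i" "x j"] injD[OF assms(1), of i j]
      by (auto simp: isotonic_edges_def)
    moreover have "(x i, x l) \<in> R"
      using ij jl transD[OF tr, of "x i" "x j" "x l"] by (simp add: isotonic_edges_def)
    ultimately show "(i, l) \<in> isotonic_edges R x"
      by (simp add: isotonic_edges_def)
  qed
  show "irrefl (isotonic_edges R x)"
    by (auto simp: irrefl_def isotonic_edges_def)
qed

lemma ex_max_vertex_above:
  fixes E :: "'n::finite rel"
  assumes "trans E" "irrefl E"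
  shows "\<exists>j\<in>max_vertices E. i = j \<or> (i, j) \<in> E"
proof -
  have "wf (E\<inverse>)"
    using assms by (intro finite_acyclic_wf_converse) (auto simp: acyclic_irrefl)
  then show ?thesis
  proof (induction i rule: wf_induct_rule)
    case (less i)
    show ?case
    proof (cases "i \<in> max_vertices E")
      case False
      then obtain i' where "(i, i') \<in> E"
        by (auto simp: max_vertices_def)
      then show ?thesis
        using less.IH[of i'] transD[OF \<open>trans E\<close>] by blast
    qed auto
  qed
qed

lemma ex_min_vertex_below:
  fixes E :: "'n::finite rel"
  assumes "trans E" "irrefl E"
  shows "\<exists>j\<in>min_vertices E. i = j \<or> (j, i) \<in> E"
  using ex_max_vertex_above[of "E\<inverse>" i] assms
  by (simp add: max_vertices_def min_vertices_def irrefl_def)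

text \<open>
  The constraint between maximal and minimal vertices relates distinct vertices only. If the maximal
  vertex above \<open>i\<close> and the minimal vertex below \<open>j\<close> coincide, then isotonicity alone gives
  \<open>z $ i \<le> z $ j\<close>.
\<close>

lemma bounded_isotonic_set_spread:
  fixes E :: "'n::finite rel"
  assumes "trans E" "irrefl E" "0 \<le> \<gamma>" "z \<in> bounded_isotonic_set E \<gamma>"
  shows "z $ i \<le> z $ j + \<gamma>"
proof -
  obtain i' where i': "i' \<in> max_vertices E" "i = i' \<or> (i, i') \<in> E"
    using ex_max_vertex_above[OF assms(1,2)] by blast
  obtain j' where j': "j' \<in> min_vertices E" "j = j' \<or> (j', j) \<in> E"
    using ex_min_vertex_below[OF assms(1,2)] by blast
  have "z $ i \<le> z $ i'" "z $ j' \<le> z $ j"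
    using i' j' assms(4) by (auto simp: bounded_isotonic_set_def)
  moreover have "z $ i' \<le> z $ j' + \<gamma>"
    using i' j' assms(3,4) by (cases "i' = j'") (auto simp: bounded_isotonic_set_def)
  ultimately show ?thesis by linarith
qed

lemma isotonic_lse_obtuse:
  assumes "z \<in> isotonic_cone E"
  shows "(y - isotonic_lse E y) \<bullet> (z - isotonic_lse E y) \<le> 0"
proof -
  have "isotonic_lse E y = closest_point (isotonic_cone E) y"
    using isotonic_lse_unique[of y E] is_arg_min_projection_iff[OF closed_convex_nonempty_isotonic_cone, of y E]
    by blast
  then show ?thesis
    using closest_point_dot[OF closed_convex_nonempty_isotonic_cone(2,1) assms, of y] by simp
qed

lemma isotonic_lse_in_cone: "isotonic_lse E y \<in> isotonic_cone E"
  using isotonic_lse_unique[of y E "isotonic_lse E y"] by (simp add: is_arg_min_def)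

lemma isotonic_cone_add: "u \<in> isotonic_cone E \<Longrightarrow> v \<in> isotonic_cone E \<Longrightarrow> u + v \<in> isotonic_cone E"
  by (fastforce simp: isotonic_cone_def intro: add_mono)

text \<open>A convex cone contains \<open>\<theta>hat + z\<close> along with \<open>z\<close>, so the projection may be tested against that vector.\<close>

lemma isotonic_lse_residual_nonpos:
  assumes "z \<in> isotonic_cone E"
  shows "(y - isotonic_lse E y) \<bullet> z \<le> 0"
  using isotonic_lse_obtuse[OF isotonic_cone_add[OF isotonic_lse_in_cone[of E y] assms], of y] by simp

text \<open>
  If \<open>w\<close> can be both added to and subtracted from the estimator without leaving the cone, then both
  signs of the variational inequality hold.
\<close>

lemma isotonic_lse_residual_orthogonal:
  assumes "w \<in> isotonic_cone E" "isotonic_lse E y - w \<in> isotonic_cone E"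
  shows "(y - isotonic_lse E y) \<bullet> w = 0"
  using isotonic_lse_residual_nonpos[OF assms(1), of y] isotonic_lse_obtuse[OF assms(2), of y]
  by simp

text \<open>
  The variational inequality suffices for minimality, by the expansion
  \<open>\<parallel>y - z\<parallel>\<^sup>2 = \<parallel>y - w\<parallel>\<^sup>2 - 2 (y - w) \<bullet> (z - w) + \<parallel>z - w\<parallel>\<^sup>2\<close>.
\<close>

lemma bounded_isotonic_lse_eqI:
  assumes "0 \<le> \<gamma>" "w \<in> bounded_isotonic_set E \<gamma>"
    and "\<And>z. z \<in> bounded_isotonic_set E \<gamma> \<Longrightarrow> (y - w) \<bullet> (z - w) \<le> 0"
  shows "bounded_isotonic_lse E y \<gamma> = w"
proof -
  have "(norm (y - w))\<^sup>2 \<le> (norm (y - z))\<^sup>2" if "z \<in> bounded_isotonic_set E \<gamma>" for z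
  proof -
    have "(norm (y - z))\<^sup>2 = (norm (y - w))\<^sup>2 - 2 * ((y - w) \<bullet> (z - w)) + (norm (z - w))\<^sup>2"
      by (simp add: power2_norm_eq_inner algebra_simps inner_commute)
    then show ?thesis
      using assms(3)[OF that] zero_le_power2[of "norm (z - w)"] by linarith
  qed
  then show ?thesis
    using bounded_isotonic_lse_unique[OF assms(1), of y E w] assms(2)
    by (auto simp: is_arg_min_linorder)
qed

section \<open>The bounded estimator is a clipped unbounded estimator\<close>

lemma bounded_isotonic_lse_eq_clip:
  fixes E :: "'n::finite rel" and y :: "real ^ 'n"
  assumes "trans E" "irrefl E" "0 \<le> \<gamma>"
    and root: "(\<Sum>i\<in>UNIV. clip L \<gamma> (isotonic_lse E y $ i) - isotonic_lse E y $ i) = 0"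
  shows "bounded_isotonic_lse E y \<gamma> = (\<chi> i. clip L \<gamma> (isotonic_lse E y $ i))"
proof (rule bounded_isotonic_lse_eqI[OF assms(3)])
  let ?t = "isotonic_lse E y" and ?w = "\<chi> i. clip L \<gamma> (isotonic_lse E y $ i)"
  have t_iso: "?t $ i \<le> ?t $ j" if "(i, j) \<in> E" for i j
    using isotonic_lse_in_cone[of E y] that by (auto simp: isotonic_cone_def)
  have w_cone: "?w \<in> isotonic_cone E"
    using t_iso by (auto simp: isotonic_cone_def intro: clip_mono)
  have "?t - ?w \<in> isotonic_cone E"
    using clip_contracts[OF t_iso, where L = L and \<gamma> = \<gamma>] by (fastforce simp: isotonic_cone_def)
  then have orth: "(y - ?t) \<bullet> ?w = 0"
    by (rule isotonic_lse_residual_orthogonal[OF w_cone])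
  have "clip L \<gamma> u \<le> clip L \<gamma> v + \<gamma>" for u v
    using \<open>0 \<le> \<gamma>\<close> by (auto simp: clip_def max_def min_def)
  then show "?w \<in> bounded_isotonic_set E \<gamma>"
    using w_cone by (auto simp: bounded_isotonic_set_def isotonic_cone_def)
  fix z
  assume z: "z \<in> bounded_isotonic_set E \<gamma>"
  define m where "m = Min (range (\<lambda>i. z $ i))"
  obtain j where j: "m = z $ j"
    using Min_in[of "range (\<lambda>i. z $ i)"] by (fastforce simp: m_def)
  have m: "m \<le> z $ i" "z $ i \<le> m + \<gamma>" for i
    using bounded_isotonic_set_spread[OF assms(1-3) z, of i j] by (simp add: m_def, simp add: j)
  have "(?t - ?w) \<bullet> (z - ?w) \<le> 0"
    using sum_clip_obtuse[OF root \<open>0 \<le> \<gamma>\<close>, of m "\<lambda>i. z $ i"] m by (simp add: inner_vec_def)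
  moreover have "(y - ?t) \<bullet> z \<le> 0"
    using z by (intro isotonic_lse_residual_nonpos)
      (auto simp: isotonic_cone_def bounded_isotonic_set_def)
  moreover have "(y - ?w) \<bullet> (z - ?w) = (y - ?t) \<bullet> z - (y - ?t) \<bullet> ?w + (?t - ?w) \<bullet> (z - ?w)"
    by (simp add: algebra_simps)
  ultimately show "(y - ?w) \<bullet> (z - ?w) \<le> 0"
    using orth by linarith
qed

text \<open>
  By \<open>clip_diff\<close>, the two terms of \<open>H\<close> at a value \<open>v s\<close> add up to the change of \<open>v s\<close> under
  clipping, and \<open>k s\<close> counts the vertices with that value.
\<close>

lemma level_H_eq_sum_clip:
  fixes c :: "'n::finite \<Rightarrow> real"
  assumes "inj_on v {1..r}" "v ` {1..r} = range c"
    and "\<And>s. s \<in> {1..r} \<Longrightarrow> k s = card {i. c i = v s}" and "0 \<le> \<gamma>"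
  shows "level_H r k v L \<gamma> = (\<Sum>i\<in>UNIV. clip L \<gamma> (c i) - c i)"
proof -
  let ?g = "\<lambda>t. clip L \<gamma> t - t"
  have "(\<Sum>i\<in>UNIV. ?g (c i)) = (\<Sum>t\<in>range c. \<Sum>i | c i = t. ?g (c i))"
    using sum.group[of UNIV "range c" c "\<lambda>i. ?g (c i)"] by simp
  also have "\<dots> = (\<Sum>t\<in>range c. real (card {i. c i = t}) * ?g t)"
    by (intro sum.cong refl) simp
  also have "\<dots> = (\<Sum>s=1..r. real (k s) * ?g (v s))"
    unfolding assms(2)[symmetric] using assms(1,3) by (simp add: sum.reindex)
  also have "\<dots> = level_H r k v L \<gamma>"
    by (simp add: level_H_def clip_diff[OF \<open>0 \<le> \<gamma>\<close>] sum.distrib distrib_left)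
  finally show ?thesis ..
qed

theorem proposition5p3:
  fixes x :: "'n::finite \<Rightarrow> 'a" and R :: "'a rel" and y \<theta>hat :: "real ^ 'n"
    and E :: "'n rel" and r :: nat and \<theta>b :: "nat \<Rightarrow> real" and U :: "nat \<Rightarrow> 'n set"
    and k :: "nat \<Rightarrow> nat"
  assumes "inj x" and "partial_order_on (range x) R"
    and "E = isotonic_edges R x"
    and "\<theta>hat = isotonic_lse E y"
    and "strict_mono_on {1..r} \<theta>b" and "\<theta>b ` {1..r} = range (\<lambda>i. \<theta>hat $ i)"
    and "\<And>s. s \<in> {1..r} \<Longrightarrow> U s = {i. \<theta>hat $ i = \<theta>b s}"
    and "\<And>s. s \<in> {1..r} \<Longrightarrow> k s = card (U s)"
  shows "(\<forall>\<gamma>. 0 \<le> \<gamma> \<and> \<gamma> \<le> \<theta>b r - \<theta>b 1 \<longrightarrow>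
            continuous_on UNIV (\<lambda>L. level_H r k \<theta>b L \<gamma>) \<and>
            strict_mono (\<lambda>L. level_H r k \<theta>b L \<gamma>) \<and>
            filterlim (\<lambda>L. level_H r k \<theta>b L \<gamma>) at_bot at_bot \<and>
            filterlim (\<lambda>L. level_H r k \<theta>b L \<gamma>) at_top at_top \<and>
            (\<exists>!L. level_H r k \<theta>b L \<gamma> = 0) \<and>
            (\<forall>s\<in>{1..r}. \<forall>i\<in>U s.
               bounded_isotonic_lse E y \<gamma> $ i =
                 max (level_root r k \<theta>b \<gamma>) (min (level_root r k \<theta>b \<gamma> + \<gamma>) (\<theta>b s)))) \<and>
         antimono_on {0..\<theta>b r - \<theta>b 1} (level_root r k \<theta>b)"
proof -
  let ?c = "\<lambda>i. \<theta>hat $ i"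
  let ?H = "\<lambda>\<gamma> L. \<Sum>i\<in>UNIV. clip L \<gamma> (?c i) - ?c i"
  have E: "trans E" "irrefl E"
    using trans_irrefl_isotonic_edges[OF assms(1,2)] assms(3) by auto
  have H: "level_H r k \<theta>b L \<gamma> = ?H \<gamma> L" if "0 \<le> \<gamma>" for L \<gamma>
    using that assms(7,8) by (intro level_H_eq_sum_clip[OF strict_mono_on_imp_inj_on[OF assms(5)] assms(6)]) auto
  have "{1..r} \<noteq> {}"
    using assms(6) by fastforce
  then have "1 \<in> {1..r}" "r \<in> {1..r}"
    by auto
  then have "\<theta>b 1 \<in> range ?c" "\<theta>b r \<in> range ?c"
    using assms(6) by blast+
  then obtain a b where ab: "\<theta>b 1 = ?c a" "\<theta>b r = ?c b"
    by auto
  have mono: "strict_mono (?H \<gamma>)" and ex1: "\<exists>!L. ?H \<gamma> L = 0"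
    if "0 \<le> \<gamma>" "\<gamma> \<le> \<theta>b r - \<theta>b 1" for \<gamma>
    using that sum_clip_strict_mono[of \<gamma> ?c b a] sum_clip_unique_root[of \<gamma> ?c b a]
    unfolding ab by simp_all
  have root: "?H \<gamma> (level_root r k \<theta>b \<gamma>) = 0" if "0 \<le> \<gamma>" "\<gamma> \<le> \<theta>b r - \<theta>b 1" for \<gamma>
    unfolding level_root_def H[OF that(1)] by (rule theI'[OF ex1[OF that]])
  have formula: "bounded_isotonic_lse E y \<gamma> $ i =
      max (level_root r k \<theta>b \<gamma>) (min (level_root r k \<theta>b \<gamma> + \<gamma>) (\<theta>b s))"
    if "0 \<le> \<gamma>" "\<gamma> \<le> \<theta>b r - \<theta>b 1" "s \<in> {1..r}" "i \<in> U s" for \<gamma> s i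
    using bounded_isotonic_lse_eq_clip[OF E that(1) root[OF that(1,2), unfolded assms(4)]] that assms(4,7)
    by (simp add: clip_def)
  have "antimono_on {0..\<theta>b r - \<theta>b 1} (level_root r k \<theta>b)"
  proof (rule monotone_onI)
    fix \<gamma> \<gamma>' :: real
    let ?L = "level_root r k \<theta>b \<gamma>" and ?L' = "level_root r k \<theta>b \<gamma>'"
    assume g: "\<gamma> \<in> {0..\<theta>b r - \<theta>b 1}" "\<gamma>' \<in> {0..\<theta>b r - \<theta>b 1}" "\<gamma> \<le> \<gamma>'"
    have "?H \<gamma>' ?L' = ?H \<gamma> ?L"
      using root g by simp
    also have "\<dots> \<le> ?H \<gamma>' ?L"
      using g by (intro sum_mono diff_right_mono clip_mono_level) auto
    finally show "?L' \<le> ?L"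
      using strict_mono_less_eq[OF mono[of \<gamma>']] g by simp
  qed
  moreover have "continuous_on UNIV (\<lambda>L. level_H r k \<theta>b L \<gamma>) \<and>
      strict_mono (\<lambda>L. level_H r k \<theta>b L \<gamma>) \<and>
      filterlim (\<lambda>L. level_H r k \<theta>b L \<gamma>) at_bot at_bot \<and>
      filterlim (\<lambda>L. level_H r k \<theta>b L \<gamma>) at_top at_top \<and>
      (\<exists>!L. level_H r k \<theta>b L \<gamma> = 0)"
    if "0 \<le> \<gamma>" "\<gamma> \<le> \<theta>b r - \<theta>b 1" for \<gamma>
    unfolding H[OF that(1)]
    by (intro conjI continuous_on_sum_clip mono ex1 that filterlim_sum_clip_at_top filterlim_sum_clip_at_bot)
  ultimately show ?thesis
    using formula by blast
qed

end
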